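(* Let $k$ be an algebraically closed field of characteristic $0$. The algebra $R=k\langle x,y\rangle/(xy-yx-y^2)$ is residually finite dimensional.
   Context: A $k$-algebra $R$ is residually finite dimensional if the intersection of the kernels of all its finite-dimensional representations is zero, i.e. for every nonzero $a\in R$ there is a finite-dimensional representation $\rho$ of $R$ with $\rho(a)\neq 0$. *)

theory Defs
  imports "HOL-Library.Poly_Mapping" "HOL-Algebra.QuotRing" "HOL-Algebra.Module"
    "Jordan_Normal_Form.VS_Connect"
begin

text \<open>Associative unital algebras. The library locale \<^locale>\<open>algebra\<close> is for commutative
  algebras only. Scalars are taken from a type of class \<^class>\<open>field\<close>, viewed as the ring
  \<^const>\<open>class_ring\<close>.\<close>

locale assoc_algebra =
  Module.module "class_ring :: 'k :: field ring" A + ring A for A :: "('k :: field, 'a) module" (structure) +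
  assumes smult_mult_left:
      "\<lbrakk>x \<in> carrier A; y \<in> carrier A\<rbrakk> \<Longrightarrow> (c \<odot> x) \<otimes> y = c \<odot> (x \<otimes> y)"
    and smult_mult_right:
      "\<lbrakk>x \<in> carrier A; y \<in> carrier A\<rbrakk> \<Longrightarrow> x \<otimes> (c \<odot> y) = c \<odot> (x \<otimes> y)"

text \<open>A finite-dimensional representation is a unital algebra homomorphism into
  the endomorphism algebra of a finite-dimensional space, which is identified with a matrix algebra
  by the choice of a basis. The dimension 0 is allowed.\<close>

definition fd_representation ::
    "('k :: field, 'a) module \<Rightarrow> nat \<Rightarrow> ('a \<Rightarrow> 'k mat) \<Rightarrow> bool" where
  "fd_representation A n \<rho> \<longleftrightarrow>
     \<rho> \<in> Ring.ring_hom A (module_mat TYPE('k) n n) \<and>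
     (\<forall>c. \<forall>a\<in>carrier A. \<rho> (c \<odot>\<^bsub>A\<^esub> a) = c \<cdot>\<^sub>m \<rho> a)"

definition residually_finite_dimensional :: "('k :: field, 'a) module \<Rightarrow> bool" where
  "residually_finite_dimensional A \<longleftrightarrow>
     (\<forall>a\<in>carrier A. a \<noteq> \<zero>\<^bsub>A\<^esub> \<longrightarrow> (\<exists>n \<rho>. fd_representation A n \<rho> \<and> \<rho> a \<noteq> 0\<^sub>m n n))"

text \<open>The free algebra is the monoid algebra of the free monoid. Since the product of
  \<^type>\<open>poly_mapping\<close> is convolution over an additively written monoid, concatenation of words
  is written as addition; words are wrapped so as not to make \<^type>\<open>list\<close> an instance of
  \<^class>\<open>monoid_add\<close>.\<close>

datatype 'g free_word = Word "'g list"

instantiation free_word :: (type) monoid_add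
begin

definition zero_free_word :: "'g free_word" where
  "zero_free_word = Word []"

fun plus_free_word :: "'g free_word \<Rightarrow> 'g free_word \<Rightarrow> 'g free_word" where
  "plus_free_word (Word u) (Word v) = Word (u @ v)"

instance
proof
  fix a b c :: "'g free_word"
  show "a + b + c = a + (b + c)"
    by (cases a; cases b; cases c) simp
  show "0 + a = a" "a + 0 = a"
    by (cases a; simp add: zero_free_word_def)+
qed

end

definition free_algebra :: "('k :: field, 'g free_word \<Rightarrow>\<^sub>0 'k) module" where
  "free_algebra =
     \<lparr>carrier = UNIV, mult = (*), one = 1, zero = 0, add = (+),
      smult = (\<lambda>c. Poly_Mapping.map ((*) c))\<rparr>"

definition gen :: "'g \<Rightarrow> 'g free_word \<Rightarrow>\<^sub>0 'k :: field" where
  "gen g = Poly_Mapping.single (Word [g]) 1"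

text \<open>\<^const>\<open>FactRing\<close> with the induced scalar multiplication,
  defined on cosets in the manner of \<^const>\<open>rcoset_mult\<close>.\<close>

definition quotient_algebra ::
    "('k :: field, 'a) module \<Rightarrow> 'a set \<Rightarrow> ('k, 'a set) module" where
  "quotient_algebra A I =
     ring.extend (A Quot I)
       (module.fields (\<lambda>c X. \<Union>x\<in>X. I +>\<^bsub>A\<^esub> (c \<odot>\<^bsub>A\<^esub> x)))"

datatype xy = X | Y

text \<open>The algebra \<open>k\<langle>x,y\<rangle>/(xy - yx - y\<^sup>2)\<close>; \<^const>\<open>genideal\<close> is the two-sided ideal
  generated by a set.\<close>

definition jordan_plane :: "('k :: field, (xy free_word \<Rightarrow>\<^sub>0 'k) set) module" where
  "jordan_plane =
     quotient_algebra free_algebra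
       (genideal free_algebra {gen X * gen Y - gen Y * gen X - gen Y ^ 2})"

lemma assoc_algebra_free_algebra: "assoc_algebra (free_algebra :: ('k :: field, 'g free_word \<Rightarrow>\<^sub>0 'k) module)"
proof -
  let ?F = "free_algebra :: ('k, 'g free_word \<Rightarrow>\<^sub>0 'k) module"
  have sm: "Poly_Mapping.map ((*) c) p = Poly_Mapping.single 0 c * p"
    for c :: 'k and p :: "'g free_word \<Rightarrow>\<^sub>0 'k"
    by (rule mult_map_scale_conv_mult)
  have comm: "p * Poly_Mapping.single 0 c = Poly_Mapping.single 0 c * p"
    for c :: 'k and p :: "'g free_word \<Rightarrow>\<^sub>0 'k"
  proof (induction p rule: update_induct)
    case (update p a b)
    then have "Poly_Mapping.update a b p = Poly_Mapping.single a b + p"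
      by (intro poly_mapping_eqI)
        (auto simp: lookup_update lookup_add lookup_single when_def in_keys_iff)
    with update show ?case
      by (simp add: distrib_left distrib_right mult_single mult.commute)
  qed simp
  have ring: "ring ?F"
  proof (rule ringI)
    show "abelian_group ?F"
    proof (rule abelian_groupI)
      fix x assume "x \<in> carrier ?F"
      show "\<exists>y\<in>carrier ?F. y \<oplus>\<^bsub>?F\<^esub> x = \<zero>\<^bsub>?F\<^esub>"
        by (rule bexI[of _ "- x"]) (auto simp: free_algebra_def)
    qed (auto simp: free_algebra_def algebra_simps)
    show "Group.monoid ?F"
      by (rule monoidI) (auto simp: free_algebra_def algebra_simps)
  qed (auto simp: free_algebra_def algebra_simps)
  interpret ring ?F by (rule ring)
  interpret K: field "class_ring :: 'k ring" by (rule class_field)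
  show ?thesis
  proof
    fix x y :: "'g free_word \<Rightarrow>\<^sub>0 'k" and c :: 'k
    show "x \<otimes>\<^bsub>?F\<^esub> (c \<odot>\<^bsub>?F\<^esub> y) = c \<odot>\<^bsub>?F\<^esub> (x \<otimes>\<^bsub>?F\<^esub> y)"
      using comm[of x c] by (simp add: free_algebra_def sm flip: mult.assoc)
  qed (auto simp: free_algebra_def sm algebra_simps single_add mult_single
        simp flip: mult.assoc)
qed

lemma (in assoc_algebra) assoc_algebra_quotient_algebra:
  assumes "ideal I A"
  shows "assoc_algebra (quotient_algebra A I)"
proof -
  interpret I: ideal I A by (rule assms)
  let ?Q = "quotient_algebra A I"
  have Q_simps [simp]:
    "carrier ?Q = carrier (A Quot I)" "mult ?Q = mult (A Quot I)" "one ?Q = one (A Quot I)"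
    "zero ?Q = zero (A Quot I)" "add ?Q = add (A Quot I)"
    by (simp_all add: quotient_algebra_def ring.defs module.defs)
  have smult_I: "c \<odot> x \<in> I" if "x \<in> I" for c x
  proof -
    have x: "x \<in> carrier A"
      using that by (rule I.a_Hcarr)
    have "c \<odot> x = (c \<odot> \<one>) \<otimes> x"
      using x by (simp add: smult_mult_left)
    also have "\<dots> \<in> I"
      using that by (intro I.I_l_closed) simp_all
    finally show ?thesis .
  qed
  have smult_Q: "c \<odot>\<^bsub>?Q\<^esub> (I +> x) = I +> (c \<odot> x)" if x: "x \<in> carrier A" for c x
  proof -
    have "I +> (c \<odot> y) = I +> (c \<odot> x)" if y: "y \<in> I +> x" for y
    proof -
      obtain h where h: "h \<in> I" "y = h \<oplus> x"
        using y by (auto simp: a_r_coset_def')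
      have "c \<odot> y = (c \<odot> h) \<oplus> (c \<odot> x)"
        using h x I.a_Hcarr by (simp add: smult_r_distr)
      then have "c \<odot> y \<in> I +> (c \<odot> x)"
        using smult_I[OF h(1)] by (auto simp: a_r_coset_def')
      then show ?thesis
        using x by (intro I.a_repr_independence'[symmetric]) simp_all
    qed
    moreover have "x \<in> I +> x"
      using x by (rule I.a_rcos_self)
    moreover have "c \<odot>\<^bsub>?Q\<^esub> (I +> x) = (\<Union>y\<in>I +> x. I +> (c \<odot> y))"
      by (simp add: quotient_algebra_def ring.defs module.defs)
    ultimately show ?thesis
      by blast
  qed
  have Q_carrier: "X \<in> carrier (A Quot I) \<longleftrightarrow> (\<exists>x\<in>carrier A. X = I +> x)" for X
    by (auto simp: FactRing_def A_RCOSETS_def')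
  have add_Q: "(I +> x) \<oplus>\<^bsub>A Quot I\<^esub> (I +> y) = I +> (x \<oplus> y)"
    and mult_Q: "(I +> x) \<otimes>\<^bsub>A Quot I\<^esub> (I +> y) = I +> (x \<otimes> y)"
    if "x \<in> carrier A" "y \<in> carrier A" for x y
    using that by (simp_all add: FactRing_def I.a_rcos_sum I.rcoset_mult_add)
  have Q_one: "\<one>\<^bsub>A Quot I\<^esub> = I +> \<one>" and Q_zero: "\<zero>\<^bsub>A Quot I\<^esub> = I +> \<zero>"
    using I.a_rcos_const[OF I.zero_closed] by (simp_all add: FactRing_def)
  have ring: "ring ?Q"
  proof (rule ringI)
    show "abelian_group ?Q"
    proof (rule abelian_groupI)
      fix X assume "X \<in> carrier ?Q"
      then obtain x where x: "x \<in> carrier A" "X = I +> x"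
        by (auto simp: Q_carrier)
      then show "\<exists>Y\<in>carrier ?Q. Y \<oplus>\<^bsub>?Q\<^esub> X = \<zero>\<^bsub>?Q\<^esub>"
        by (intro bexI[of _ "I +> (\<ominus> x)"]) (auto simp: Q_carrier Q_zero add_Q l_neg)
    qed (auto simp: Q_carrier Q_zero add_Q a_assoc a_comm a_lcomm)
    show "Group.monoid ?Q"
      by (rule monoidI) (auto simp: Q_carrier Q_one mult_Q m_assoc)
  qed (auto simp: Q_carrier add_Q mult_Q l_distr r_distr)
  interpret Q: ring ?Q by (rule ring)
  have smult: "(c + d) \<odot> x = (c \<odot> x) \<oplus> (d \<odot> x)" "(c * d) \<odot> x = c \<odot> (d \<odot> x)" "1 \<odot> x = x"
    if "x \<in> carrier A" for c d x
    using that smult_l_distr[of c d x] smult_assoc1[of c d x] smult_one[of x] by simp_all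
  show ?thesis
  proof
  qed (auto simp: Q_carrier smult_Q add_Q mult_Q smult smult_r_distr smult_mult_left
        smult_mult_right)
qed

lemma assoc_algebra_jordan_plane:
  "assoc_algebra (jordan_plane :: ('k :: field, (xy free_word \<Rightarrow>\<^sub>0 'k) set) module)"
proof -
  interpret assoc_algebra "free_algebra :: ('k, xy free_word \<Rightarrow>\<^sub>0 'k) module"
    by (rule assoc_algebra_free_algebra)
  show ?thesis
    unfolding jordan_plane_def
    by (intro assoc_algebra_quotient_algebra genideal_ideal) (simp add: free_algebra_def)
qed

end

theory Submission
  imports Defs
begin

text \<open>
  The algebra $R$ acts on $k[y]$ in many ways: for a scalar $\lambda$ let $y$ act by
  multiplication and $x$ by $\lambda + y^2\,d/dy$; the relation is the product rule
  $[y^2\,d/dy, y] = y^2$. Both operators preserve every ideal $(y^n)$, so there is an induced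
  representation of dimension $n$ on $k[y]/(y^n)$
  (\<open>fd_representation_truncated\<close>, \<open>jordan_act_relation\<close>).

  The relation, read as $xy = yx + y^2$, moves all occurrences of $y$ to the left, so each element
  $a$ of $R$ is a sum $\sum_i y^i p_i(x)$ with polynomials $p_i$ (\<open>ex_normal_form\<close>). Since the
  derivative kills constants, $x \cdot 1 = \lambda$, hence
  $a \cdot 1 = \sum_i p_i(\lambda) y^i$ (\<open>coeff_jordan_act_normal_form\<close>). If $a \noteq 0$, some
  $p_i$ is not the zero polynomial, and in characteristic $0$ it has a non-root $\lambda$. For this
  $\lambda$ and $n = i + 1$, the element $a$ acts nontrivially on $k[y]/(y^n)$.
\<close>

section \<open>Actions of the free algebra\<close>

lemma poly_mapping_induct_single [case_names zero single_add]:
  assumes "P 0"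
    and "\<And>w c a. P a \<Longrightarrow> P (Poly_Mapping.single w c + a)"
  shows "P (a :: 'w \<Rightarrow>\<^sub>0 'k :: comm_monoid_add)"
proof (induction a rule: update_induct)
  case const
  show ?case by (rule assms(1))
next
  case (update a w c)
  then have "Poly_Mapping.update w c a = Poly_Mapping.single w c + a"
    by (intro poly_mapping_eqI)
      (auto simp: lookup_update lookup_add lookup_single when_def in_keys_iff)
  with update assms(2) show ?case by simp
qed

lemma scalar_mult_commute:
  fixes a :: "'g free_word \<Rightarrow>\<^sub>0 'k :: field"
  shows "a * Poly_Mapping.single 0 c = Poly_Mapping.single 0 c * a"
  by (induction a rule: poly_mapping_induct_single)
    (simp_all add: distrib_left distrib_right mult_single mult.commute)

locale free_algebra_action = vector_space scale
  for scale :: "'k :: field \<Rightarrow> 'v :: ab_group_add \<Rightarrow> 'v" +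
  fixes T :: "'g \<Rightarrow> 'v \<Rightarrow> 'v"
  assumes T_add: "T g (u + v) = T g u + T g v"
    and T_scale: "T g (scale c v) = scale c (T g v)"
begin

fun word_act :: "'g free_word \<Rightarrow> 'v \<Rightarrow> 'v" where
  "word_act (Word gs) v = foldr T gs v"

lemma word_act_add: "word_act w (u + v) = word_act w u + word_act w v"
proof (cases w)
  case (Word gs)
  have "foldr T gs (u + v) = foldr T gs u + foldr T gs v"
    by (induction gs) (simp_all add: T_add)
  with Word show ?thesis by simp
qed

lemma word_act_scale: "word_act w (scale c v) = scale c (word_act w v)"
proof (cases w)
  case (Word gs)
  have "foldr T gs (scale c v) = scale c (foldr T gs v)"
    by (induction gs) (simp_all add: T_scale)
  with Word show ?thesis by simp
qed

lemma word_act_plus: "word_act (w + w') v = word_act w (word_act w' v)"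
  by (cases w; cases w') simp

definition act :: "('g free_word \<Rightarrow>\<^sub>0 'k) \<Rightarrow> 'v \<Rightarrow> 'v" where
  "act a v = (\<Sum>w\<in>Poly_Mapping.keys a. scale (Poly_Mapping.lookup a w) (word_act w v))"

lemma act_superset:
  assumes "finite S" "Poly_Mapping.keys a \<subseteq> S"
  shows "act a v = (\<Sum>w\<in>S. scale (Poly_Mapping.lookup a w) (word_act w v))"
  unfolding act_def
  by (rule sum.mono_neutral_left) (use assms in \<open>auto simp: in_keys_iff\<close>)

lemma act_zero [simp]: "act 0 v = 0"
  by (simp add: act_def)

lemma act_single [simp]: "act (Poly_Mapping.single w c) v = scale c (word_act w v)"
  by (subst act_superset[where S = "{w}"]) auto

lemma act_plus: "act (a + b) v = act a v + act b v"
proof -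
  let ?S = "Poly_Mapping.keys a \<union> Poly_Mapping.keys b"
  have "Poly_Mapping.keys (a + b) \<subseteq> ?S"
    by (rule keys_add)
  then show ?thesis
    by (simp add: act_superset[where S = ?S] lookup_add scale_left_distrib sum.distrib)
qed

lemma act_minus: "act (a - b) v = act a v - act b v"
  using act_plus[of "a - b" b v] by (simp add: algebra_simps)

lemma act_one [simp]: "act 1 v = v"
proof -
  have "act (Poly_Mapping.single 0 1) v = v"
    by (subst act_single) (simp add: zero_free_word_def)
  then show ?thesis by simp
qed

lemma act_gen [simp]: "act (gen g) v = T g v"
  by (simp add: gen_def)

lemma act_add_right: "act a (u + v) = act a u + act a v"
  by (simp add: act_def word_act_add scale_right_distrib sum.distrib)

lemma act_scale_right: "act a (scale c v) = scale c (act a v)"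
  by (simp add: act_def word_act_scale scale_sum_right mult.commute)

lemma act_sum_right: "act a (\<Sum>i\<in>S. f i) = (\<Sum>i\<in>S. act a (f i))"
proof -
  have "act a 0 = 0"
    using act_scale_right[of a 0 0] by simp
  then show ?thesis
    by (induction S rule: infinite_finite_induct) (simp_all add: act_add_right)
qed

lemma act_mult: "act (a * b) v = act a (act b v)"
proof (induction a rule: poly_mapping_induct_single)
  case zero
  show ?case by simp
next
  case (single_add w c a)
  have "act (Poly_Mapping.single w c * b) v = scale c (word_act w (act b v))"
  proof (induction b rule: poly_mapping_induct_single)
    case zero
    have "word_act w 0 = 0"
      using word_act_scale[of w 0 0] by simp
    then show ?case by simp
  next
    case (single_add w' d b)
    then show ?case
      by (simp add: distrib_left act_plus mult_single word_act_plus word_act_add word_act_scale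
          scale_right_distrib)
  qed
  with single_add show ?case
    by (simp add: distrib_right act_plus)
qed

end

section \<open>Truncation to finite dimension\<close>

locale filtered_poly_action =
  free_algebra_action Polynomial.smult T
  for T :: "'g \<Rightarrow> ('k :: field) poly \<Rightarrow> 'k poly" +
  assumes T_dvd: "monom 1 n dvd f \<Longrightarrow> monom 1 n dvd T g f"
begin

lemma act_dvd:
  assumes "monom 1 n dvd f"
  shows "monom 1 n dvd act a f"
proof -
  have "monom 1 n dvd foldr T gs f" for gs
    by (induction gs) (simp_all add: assms T_dvd)
  then have "monom 1 n dvd word_act w f" for w
    by (cases w) simp
  then show ?thesis
    unfolding act_def by (intro dvd_sum dvd_smult)
qed

text \<open>The matrix of the action on $k[y]/(y^n)$ in the basis $1, y, \dots, y^{n-1}$.\<close>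

definition truncated_rep :: "nat \<Rightarrow> ('g free_word \<Rightarrow>\<^sub>0 'k) \<Rightarrow> 'k mat" where
  "truncated_rep n a = mat n n (\<lambda>(i, j). poly.coeff (act a (monom 1 j)) i)"

text \<open>The part of $f$ of order at least $n$ is sent into $(y^n)$, so the coefficients of the image
  below $n$ depend only on $f$ modulo $y^n$. This makes the truncated matrices multiplicative.\<close>

lemma coeff_act:
  assumes "i < n"
  shows "poly.coeff (act a f) i = (\<Sum>l<n. poly.coeff (act a (monom 1 l)) i * poly.coeff f l)"
proof -
  define r where "r = f - (\<Sum>l<n. monom (poly.coeff f l) l)"
  have "monom 1 n dvd r"
    by (auto simp: r_def monom_1_dvd_iff' coeff_sum)
  then have r: "poly.coeff (act a r) i = 0"
    using act_dvd assms unfolding monom_1_dvd_iff' by blast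
  have "f = (\<Sum>l<n. Polynomial.smult (poly.coeff f l) (monom 1 l)) + r"
    by (simp add: r_def smult_monom)
  then have "act a f = act a ((\<Sum>l<n. Polynomial.smult (poly.coeff f l) (monom 1 l)) + r)"
    by (rule arg_cong)
  then have "act a f = (\<Sum>l<n. Polynomial.smult (poly.coeff f l) (act a (monom 1 l))) + act a r"
    by (simp only: act_add_right act_sum_right act_scale_right)
  with r show ?thesis
    by (simp add: coeff_sum mult.commute)
qed

lemma fd_representation_truncated: "fd_representation free_algebra n (truncated_rep n)"
  unfolding fd_representation_def
proof (intro conjI allI ballI)
  show "truncated_rep n \<in> Ring.ring_hom free_algebra (module_mat TYPE('k) n n)"
  proof (rule ring_hom_memI)
    fix a b :: "'g free_word \<Rightarrow>\<^sub>0 'k"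
    have "truncated_rep n (a * b) = truncated_rep n a * truncated_rep n b"
      by (rule eq_matI)
        (auto simp: truncated_rep_def act_mult coeff_act[where f = "act b (monom 1 j)" for j]
          scalar_prod_def atLeast0LessThan)
    then show "truncated_rep n (a \<otimes>\<^bsub>free_algebra\<^esub> b)
        = truncated_rep n a \<otimes>\<^bsub>module_mat TYPE('k) n n\<^esub> truncated_rep n b"
      by (simp add: free_algebra_def module_mat_simps)
    have "truncated_rep n (a + b) = truncated_rep n a + truncated_rep n b"
      by (rule eq_matI) (auto simp: truncated_rep_def act_plus)
    then show "truncated_rep n (a \<oplus>\<^bsub>free_algebra\<^esub> b)
        = truncated_rep n a \<oplus>\<^bsub>module_mat TYPE('k) n n\<^esub> truncated_rep n b"
      by (simp add: free_algebra_def module_mat_simps)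
  next
    have "truncated_rep n 1 = 1\<^sub>m n"
      by (rule eq_matI) (auto simp: truncated_rep_def)
    then show "truncated_rep n \<one>\<^bsub>free_algebra\<^esub> = \<one>\<^bsub>module_mat TYPE('k) n n\<^esub>"
      by (simp add: free_algebra_def module_mat_simps)
  qed (simp add: truncated_rep_def module_mat_simps)
next
  fix c :: 'k and a :: "'g free_word \<Rightarrow>\<^sub>0 'k"
  have "act (Poly_Mapping.map ((*) c) a) f = Polynomial.smult c (act a f)" for f
    unfolding mult_map_scale_conv_mult act_mult by (simp add: zero_free_word_def)
  then have "truncated_rep n (Poly_Mapping.map ((*) c) a) = c \<cdot>\<^sub>m truncated_rep n a"
    by (intro eq_matI) (auto simp: truncated_rep_def)
  then show "truncated_rep n (c \<odot>\<^bsub>free_algebra\<^esub> a) = c \<cdot>\<^sub>m truncated_rep n a"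
    by (simp add: free_algebra_def)
qed

end

section \<open>Representations of quotient algebras\<close>

lemma (in assoc_algebra) fd_representation_quotient:
  assumes "ideal I A" and \<rho>: "fd_representation A n \<rho>"
    and vanish: "\<And>a. a \<in> I \<Longrightarrow> \<rho> a = 0\<^sub>m n n"
  obtains \<sigma> where "fd_representation (quotient_algebra A I) n \<sigma>"
    and "\<And>a. a \<in> carrier A \<Longrightarrow> \<sigma> (I +> a) = \<rho> a"
proof -
  interpret I: ideal I A by (rule assms)
  let ?Q = "quotient_algebra A I" and ?M = "module_mat TYPE('k) n n"
  define \<sigma> where "\<sigma> C = \<rho> (SOME a. a \<in> C)" for C
  have hom: "\<rho> \<in> Ring.ring_hom A ?M"
    and sm: "\<And>c a. a \<in> carrier A \<Longrightarrow> \<rho> (c \<odot> a) = c \<cdot>\<^sub>m \<rho> a"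
    using \<rho> by (auto simp: fd_representation_def)
  have closed: "\<rho> a \<in> carrier_mat n n" if "a \<in> carrier A" for a
    using ring_hom_closed[OF hom that] by (simp add: module_mat_simps)
  \<comment> \<open>\<open>\<rho>\<close> is constant on each coset, so any choice of representative gives the induced map.\<close>
  have const: "\<rho> b = \<rho> a" if a: "a \<in> carrier A" and b: "b \<in> I +> a" for a b
  proof -
    obtain h where h: "h \<in> I" "b = h \<oplus> a"
      using b by (auto simp: a_r_coset_def')
    then have "\<rho> b = \<rho> h + \<rho> a"
      using ring_hom_add[OF hom I.a_Hcarr[OF h(1)] a] by (simp add: module_mat_simps)
    with vanish[OF h(1)] closed[OF a] show ?thesis by simp
  qed
  have \<sigma>: "\<sigma> (I +> a) = \<rho> a" if "a \<in> carrier A" for a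
    unfolding \<sigma>_def using someI[of "\<lambda>b. b \<in> I +> a", OF I.a_rcos_self[OF that]]
    by (rule const[OF that])
  have scalar: "c \<odot> x \<in> I" if "x \<in> I" for c x
  proof -
    have x: "x \<in> carrier A" using that by (rule I.a_Hcarr)
    have "(c \<odot> \<one>) \<otimes> x \<in> I" using that by (intro I.I_l_closed) simp_all
    then show ?thesis using x by (simp add: smult_mult_left)
  qed
  have smult_Q: "c \<odot>\<^bsub>?Q\<^esub> (I +> x) = I +> (c \<odot> x)" if x: "x \<in> carrier A" for c x
  proof -
    have "I +> (c \<odot> y) = I +> (c \<odot> x)" if "y \<in> I +> x" for y
    proof -
      obtain h where h: "h \<in> I" "y = h \<oplus> x"
        using \<open>y \<in> I +> x\<close> by (auto simp: a_r_coset_def')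
      then have "c \<odot> y = (c \<odot> h) \<oplus> (c \<odot> x)"
        using x I.a_Hcarr by (simp add: smult_r_distr)
      then have "c \<odot> y \<in> I +> (c \<odot> x)"
        using scalar[OF h(1)] by (auto simp: a_r_coset_def')
      then show ?thesis
        using x by (intro I.a_repr_independence'[symmetric]) simp_all
    qed
    moreover have "x \<in> I +> x" using x by (rule I.a_rcos_self)
    moreover have "c \<odot>\<^bsub>?Q\<^esub> (I +> x) = (\<Union>y\<in>I +> x. I +> (c \<odot> y))"
      by (simp add: quotient_algebra_def ring.defs module.defs)
    ultimately show ?thesis by blast
  qed
  have Q_simps: "mult ?Q = mult (A Quot I)" "one ?Q = one (A Quot I)" "add ?Q = add (A Quot I)"
    by (simp_all add: quotient_algebra_def ring.defs module.defs)
  have Q_carrier: "C \<in> carrier ?Q \<longleftrightarrow> (\<exists>x\<in>carrier A. C = I +> x)" for C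
    by (auto simp: quotient_algebra_def ring.defs module.defs FactRing_def A_RCOSETS_def')
  have add_Q: "(I +> x) \<oplus>\<^bsub>?Q\<^esub> (I +> y) = I +> (x \<oplus> y)"
    and mult_Q: "(I +> x) \<otimes>\<^bsub>?Q\<^esub> (I +> y) = I +> (x \<otimes> y)"
    if "x \<in> carrier A" "y \<in> carrier A" for x y
    using that by (simp_all add: Q_simps FactRing_def I.a_rcos_sum I.rcoset_mult_add)
  have one_Q: "\<one>\<^bsub>?Q\<^esub> = I +> \<one>"
    by (simp add: Q_simps FactRing_def)
  have "\<sigma> \<in> Ring.ring_hom ?Q ?M"
    by (rule ring_hom_memI)
      (auto simp: Q_carrier add_Q mult_Q one_Q \<sigma> ring_hom_closed[OF hom] ring_hom_mult[OF hom]
        ring_hom_add[OF hom] ring_hom_one[OF hom])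
  then have "fd_representation ?Q n \<sigma>"
    by (auto simp: fd_representation_def Q_carrier smult_Q \<sigma> sm)
  with \<sigma> show thesis by (intro that)
qed

lemma (in assoc_algebra) residually_finite_dimensional_quotient:
  assumes "ideal I A"
    and separate: "\<And>a. a \<in> carrier A \<Longrightarrow> a \<notin> I \<Longrightarrow>
      \<exists>n \<rho>. fd_representation A n \<rho> \<and> (\<forall>b\<in>I. \<rho> b = 0\<^sub>m n n) \<and> \<rho> a \<noteq> 0\<^sub>m n n"
  shows "residually_finite_dimensional (quotient_algebra A I)"
  unfolding residually_finite_dimensional_def
proof (intro ballI impI)
  interpret I: ideal I A by (rule assms)
  fix C assume "C \<in> carrier (quotient_algebra A I)" and nz: "C \<noteq> \<zero>\<^bsub>quotient_algebra A I\<^esub>"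
  then obtain a where a: "a \<in> carrier A" "C = I +> a"
    by (auto simp: quotient_algebra_def ring.defs module.defs FactRing_def A_RCOSETS_def')
  have "\<zero>\<^bsub>quotient_algebra A I\<^esub> = I"
    by (simp add: quotient_algebra_def ring.defs module.defs FactRing_def)
  with nz a I.a_rcos_const have "a \<notin> I" by auto
  with separate a obtain n \<rho> where \<rho>: "fd_representation A n \<rho>" "\<forall>b\<in>I. \<rho> b = 0\<^sub>m n n"
    and nonzero: "\<rho> a \<noteq> 0\<^sub>m n n" by blast
  obtain \<sigma> where "fd_representation (quotient_algebra A I) n \<sigma>"
    and "\<And>a. a \<in> carrier A \<Longrightarrow> \<sigma> (I +> a) = \<rho> a"
    using fd_representation_quotient[OF assms(1) \<rho>(1)] \<rho>(2) by blast
  with a nonzero show "\<exists>n \<sigma>. fd_representation (quotient_algebra A I) n \<sigma> \<and> \<sigma> C \<noteq> 0\<^sub>m n n"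
    by auto
qed

lemma fd_representation_vanishes_on_genideal:
  fixes A :: "('k :: field, 'a) module"
  assumes "assoc_algebra A" "fd_representation A n \<rho>"
    and S: "S \<subseteq> carrier A" "\<And>a. a \<in> S \<Longrightarrow> \<rho> a = 0\<^sub>m n n"
    and a: "a \<in> genideal A S"
  shows "\<rho> a = 0\<^sub>m n n"
proof -
  interpret assoc_algebra A by (rule assms(1))
  let ?M = "module_mat TYPE('k) n n"
  have "?M = ring_mat TYPE('k) n (module.fields (\<cdot>\<^sub>m))"
    by (simp add: module_mat_def ring_mat_def module.defs)
  then have "ring ?M" by (simp only: ring_mat)
  then interpret h: ring_hom_ring A ?M \<rho>
    using ring_axioms assms(2) unfolding fd_representation_def by (blast intro: ring_hom_ringI2)
  have kernel: "a_kernel A ?M \<rho> = {a \<in> carrier A. \<rho> a = 0\<^sub>m n n}"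
    unfolding a_kernel_def' module_mat_simps ..
  have "S \<subseteq> a_kernel A ?M \<rho>"
    unfolding kernel using S by blast
  then have "genideal A S \<subseteq> a_kernel A ?M \<rho>"
    by (rule genideal_minimal[OF h.kernel_is_ideal])
  with a show ?thesis
    unfolding kernel by blast
qed

section \<open>The operators on polynomials\<close>

text \<open>Coefficients may come from a commutative domain: besides the field itself, the coefficient
  ring $k[x]$ with \<open>l = x\<close> occurs, where the operator for \<^const>\<open>X\<close> computes the
  normal form of a left multiple by $x$.\<close>

fun jordan_op :: "'a :: idom \<Rightarrow> xy \<Rightarrow> 'a poly \<Rightarrow> 'a poly" where
  "jordan_op l X f = Polynomial.smult l f + pCons 0 (pCons 0 (pderiv f))"
| "jordan_op l Y f = pCons 0 f"

interpretation jordan: filtered_poly_action "jordan_op l" for l :: "'k :: field"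
proof
  fix f h :: "'k poly" and c :: 'k and g n
  show "jordan_op l g (f + h) = jordan_op l g f + jordan_op l g h"
    by (cases g) (simp_all add: smult_add_right pderiv_add)
  show "jordan_op l g (Polynomial.smult c f) = Polynomial.smult c (jordan_op l g f)"
    by (cases g) (simp_all add: smult_add_right pderiv_smult mult.commute)
  show "monom 1 n dvd jordan_op l g f" if "monom 1 n dvd f"
    using that unfolding monom_1_dvd_iff'
    by (cases g) (auto simp: coeff_pCons coeff_pderiv split: nat.split)
qed (simp_all add: smult_add_right smult_add_left)

abbreviation jordan_relation :: "xy free_word \<Rightarrow>\<^sub>0 'k :: field" where
  "jordan_relation \<equiv> gen X * gen Y - gen Y * gen X - gen Y ^ 2"

text \<open>The product rule $[y^2\,d/dy, y] = y^2$; the scalar \<open>l\<close> cancels in the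
  commutator.\<close>

lemma jordan_act_relation: "jordan.act l jordan_relation f = 0"
  by (simp add: jordan.act_minus jordan.act_mult power2_eq_square pderiv_pCons)

section \<open>Normal forms\<close>

text \<open>Horner evaluation at an element of a noncommutative ring, with the powers of the element to
  the left of the coefficients.\<close>

definition horner :: "('c :: zero \<Rightarrow> 'r) \<Rightarrow> 'r \<Rightarrow> 'c poly \<Rightarrow> 'r :: semiring_0" where
  "horner e x p = fold_coeffs (\<lambda>c s. e c + x * s) p 0"

lemma horner_0 [simp]: "horner e x 0 = 0"
  by (simp add: horner_def)

lemma horner_pCons:
  assumes "e 0 = 0"
  shows "horner e x (pCons c p) = e c + x * horner e x p"
  by (cases "c = 0 \<and> p = 0") (auto simp: horner_def assms)

lemma horner_add:
  assumes "e 0 = 0" "\<And>c d. e (c + d) = e c + e d"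
  shows "horner e x (p + q) = horner e x p + horner e x q"
  by (induction p q rule: poly_induct2)
    (simp_all add: horner_pCons assms algebra_simps)

lemma horner_smult:
  assumes "e 0 = 0" "\<And>d. e (c * d) = z * e d" "z * x = x * z"
  shows "horner e x (Polynomial.smult c p) = z * horner e x p"
proof (induction p)
  case (pCons d p)
  have "x * (z * s) = z * (x * s)" for s
    using assms(3) by (simp flip: mult.assoc)
  with pCons show ?case
    by (simp add: horner_pCons assms distrib_left)
qed simp

abbreviation eval_x :: "('k :: field) poly \<Rightarrow> xy free_word \<Rightarrow>\<^sub>0 'k" where
  "eval_x \<equiv> horner (Poly_Mapping.single 0) (gen X)"

text \<open>A polynomial $\sum_i p_i y^i$ over $k[x]$ becomes $\sum_i y^i p_i(x)$.\<close>

definition normal_form :: "('k :: field) poly poly \<Rightarrow> xy free_word \<Rightarrow>\<^sub>0 'k" where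
  "normal_form = horner eval_x (gen Y)"

lemma normal_form_0 [simp]: "normal_form 0 = 0"
  by (simp add: normal_form_def)

lemma normal_form_pCons: "normal_form (pCons p q) = eval_x p + gen Y * normal_form q"
  by (simp add: normal_form_def horner_pCons)

lemma normal_form_add: "normal_form (p + q) = normal_form p + normal_form q"
  unfolding normal_form_def by (intro horner_add) (simp_all add: single_add)

lemma normal_form_scale:
  "normal_form (Polynomial.smult [:c:] q) = Poly_Mapping.single 0 c * normal_form q"
  unfolding normal_form_def
proof (rule horner_smult)
  fix p :: "'a poly"
  have "eval_x (Polynomial.smult c p) = Poly_Mapping.single 0 c * eval_x p"
    by (rule horner_smult) (simp_all add: mult_single scalar_mult_commute[symmetric])
  then show "eval_x ([:c:] * p) = Poly_Mapping.single 0 c * eval_x p"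
    by simp
qed (simp_all add: scalar_mult_commute[symmetric])

text \<open>The constant polynomial $1$ is an eigenvector of the operator for \<^const>\<open>X\<close> with
  eigenvalue \<open>l\<close>, so each $p_i(x)$ acts on it as the scalar $p_i(l)$.\<close>

lemma coeff_jordan_act_normal_form:
  "poly.coeff (jordan.act l (normal_form q) 1) i = poly (poly.coeff q i) l"
proof -
  have x: "jordan.act l (eval_x p) 1 = [:poly p l:]" for p
  proof (induction p)
    case (pCons c p)
    then show ?case
      by (simp add: horner_pCons jordan.act_plus jordan.act_mult zero_free_word_def pderiv_pCons)
  qed simp
  show ?thesis
  proof (induction q arbitrary: i)
    case (pCons p q)
    then show ?case
      by (cases i) (simp_all add: normal_form_pCons jordan.act_plus jordan.act_mult x)
  qed simp
qed

context
  fixes I :: "(xy free_word \<Rightarrow>\<^sub>0 'k :: field) set"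
  assumes I: "ideal I free_algebra" and relation: "jordan_relation \<in> I"
begin

lemma ideal_add: "a \<in> I \<Longrightarrow> b \<in> I \<Longrightarrow> a + b \<in> I"
  using additive_subgroup.a_closed[OF ideal.axioms(1)[OF I], of a b]
  by (simp add: free_algebra_def)

lemma ideal_mult_left: "b \<in> I \<Longrightarrow> a * b \<in> I"
  using ideal.I_l_closed[OF I, of b a] by (simp add: free_algebra_def)

lemma ideal_mult_right: "b \<in> I \<Longrightarrow> b * a \<in> I"
  using ideal.I_r_closed[OF I, of b a] by (simp add: free_algebra_def)

lemma ideal_zero: "0 \<in> I"
  using additive_subgroup.zero_closed[OF ideal.axioms(1)[OF I]] by (simp add: free_algebra_def)

text \<open>Moving one $x$ past a normal form: by $xy \equiv yx + y^2$, commuting $x$ past the powers of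
  $y$ differentiates in $y$ and multiplies by $y^2$.\<close>

lemma gen_X_mult_normal_form:
  "gen X * normal_form q - normal_form (jordan_op [:0, 1:] X q) \<in> I"
proof (induction q)
  case 0
  show ?case by (simp add: ideal_zero)
next
  case (pCons p q)
  let ?D = "jordan_op [:0, 1:] X"
  let ?N = "normal_form q"
  have "?D (pCons p q) = pCons (pCons 0 p) (?D q + pCons 0 q)"
    by (simp add: pderiv_pCons algebra_simps)
  then have "normal_form (?D (pCons p q))
      = gen X * eval_x p + gen Y * (normal_form (?D q) + gen Y * ?N)"
    by (simp only: normal_form_pCons normal_form_add) (simp add: horner_pCons)
  then have "gen X * normal_form (pCons p q) - normal_form (?D (pCons p q))
      = jordan_relation * ?N + gen Y * (gen X * ?N - normal_form (?D q))"
    by (simp only: normal_form_pCons) (simp add: algebra_simps power2_eq_square)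
  then show ?case
    by (simp only:) (intro ideal_add ideal_mult_right ideal_mult_left relation pCons.IH)
qed

text \<open>Words are straightened letter by letter from the right, with the operators
  \<^const>\<open>jordan_op\<close> over $k[x]$.\<close>

lemma ex_normal_form: "\<exists>q. a - normal_form q \<in> I"
proof (induction a rule: poly_mapping_induct_single)
  case zero
  show ?case by (rule exI[of _ 0]) (simp add: ideal_zero)
next
  case (single_add w c a)
  then obtain q where q: "a - normal_form q \<in> I" ..
  have word: "\<exists>r. Poly_Mapping.single (Word gs) 1 - normal_form r \<in> I" for gs
  proof (induction gs)
    case Nil
    have "Poly_Mapping.single (Word []) (1 :: 'k) = normal_form 1"
      by (simp add: one_pCons normal_form_pCons horner_pCons flip: zero_free_word_def)
    then show ?case
      by (intro exI[of _ 1]) (simp add: ideal_zero)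
  next
    case (Cons g gs)
    then obtain r where r: "Poly_Mapping.single (Word gs) 1 - normal_form r \<in> I" ..
    let ?r' = "jordan_op [:0, 1:] g r"
    have "gen g * normal_form r - normal_form ?r' \<in> I"
    proof (cases g)
      case X
      then show ?thesis using gen_X_mult_normal_form[of r] by simp
    next
      case Y
      then show ?thesis by (simp add: normal_form_pCons ideal_zero)
    qed
    then have "gen g * (Poly_Mapping.single (Word gs) 1 - normal_form r)
        + (gen g * normal_form r - normal_form ?r') \<in> I"
      by (intro ideal_add ideal_mult_left r)
    moreover have "gen g * Poly_Mapping.single (Word gs) (1 :: 'k)
        = Poly_Mapping.single (Word (g # gs)) 1"
      by (simp add: gen_def mult_single)
    ultimately show ?case
      by (intro exI[of _ ?r']) (simp add: right_diff_distrib)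
  qed
  obtain gs where w: "w = Word gs" by (cases w)
  from word[of gs] obtain r where r: "Poly_Mapping.single w 1 - normal_form r \<in> I"
    unfolding w ..
  have "Poly_Mapping.single 0 c * (Poly_Mapping.single w 1 - normal_form r)
      + (a - normal_form q) \<in> I"
    by (intro ideal_add ideal_mult_left r q)
  then show ?case
    by (intro exI[of _ "Polynomial.smult [:c:] r + q"])
      (simp add: normal_form_add normal_form_scale right_diff_distrib mult_single algebra_simps)
qed

end

section \<open>Residual finite dimensionality\<close>

theorem mainTheorem11:
  shows "residually_finite_dimensional
    (jordan_plane :: ('k :: {alg_closed_field, field_char_0}, (xy free_word \<Rightarrow>\<^sub>0 'k) set) module)"
proof -
  let ?F = "free_algebra :: ('k, xy free_word \<Rightarrow>\<^sub>0 'k) module"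
  interpret assoc_algebra ?F by (rule assoc_algebra_free_algebra)
  define I where "I = genideal ?F {jordan_relation}"
  have sub: "{jordan_relation} \<subseteq> carrier ?F"
    by (simp add: free_algebra_def)
  have I: "ideal I ?F"
    unfolding I_def using sub by (rule genideal_ideal)
  have rel: "jordan_relation \<in> I"
    unfolding I_def using genideal_self[OF sub] by simp
  have vanish: "jordan.truncated_rep l n b = 0\<^sub>m n n" if "b \<in> I" for l n b
    using assoc_algebra_free_algebra jordan.fd_representation_truncated sub
  proof (rule fd_representation_vanishes_on_genideal)
    show "b \<in> genideal ?F {jordan_relation}"
      using that by (simp add: I_def)
    show "jordan.truncated_rep l n a = 0\<^sub>m n n" if "a \<in> {jordan_relation}" for a
      using that by (intro eq_matI) (auto simp: jordan.truncated_rep_def jordan_act_relation)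
  qed
  have "\<exists>n \<rho>. fd_representation ?F n \<rho> \<and> (\<forall>b\<in>I. \<rho> b = 0\<^sub>m n n) \<and> \<rho> a \<noteq> 0\<^sub>m n n"
    if "a \<notin> I" for a
  proof -
    obtain q where q: "a - normal_form q \<in> I"
      using ex_normal_form[OF I rel] ..
    with \<open>a \<notin> I\<close> have "q \<noteq> 0" by auto
    then obtain i where "poly.coeff q i \<noteq> 0"
      by (auto simp: poly_eq_iff)
    then obtain l where l: "poly (poly.coeff q i) l \<noteq> 0"
      using poly_all_0_iff_0 by blast
    let ?\<rho> = "jordan.truncated_rep l (Suc i)"
    \<comment> \<open>Column 0 holds the images of the polynomial $1$; size \<open>i + 1\<close> is the least that keeps
      the coefficient of $y^i$.\<close>
    have entry: "?\<rho> b $$ (i, 0) = poly.coeff (jordan.act l b 1) i" for b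
      by (simp add: jordan.truncated_rep_def)
    have "poly.coeff (jordan.act l (a - normal_form q) 1) i = 0"
      using vanish[OF q, of l "Suc i"] by (simp flip: entry)
    then have "?\<rho> a $$ (i, 0) = poly (poly.coeff q i) l"
      by (simp add: entry jordan.act_minus coeff_jordan_act_normal_form)
    with l have "?\<rho> a \<noteq> 0\<^sub>m (Suc i) (Suc i)" by auto
    with vanish jordan.fd_representation_truncated show ?thesis by blast
  qed
  then show ?thesis
    unfolding jordan_plane_def I_def[symmetric]
    by (intro residually_finite_dimensional_quotient I)
qed

end
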